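(* For $B\subseteq[k]$, the number of splitters of the one-set family $\mathcal B=\{B\}$ on $[k]$ is minimized when $|B|=k$ if $k$ is even, and when $|B|=k-1$ if $k$ is odd. The minimum number of splitters is asymptotic to $2^k/\sqrt{k}$.
   Context: Let $[k]=\{1,\dots,k\}$. For $A,B\subseteq[k]$, $A$ splits $B$ if $|A\cap B|=|B|/2$ when $|B|$ is even, and $|A\cap B|=(|B|\pm1)/2$ when $|B|$ is odd. A splitter of a family $\mathcal B$ of subsets of $[k]$ is a set $A\subseteq[k]$ that splits every $B\in\mathcal B$.
   Formalization: The minimum number of splitters is not asymptotic to 2^k/sqrt(k) with ratio tending to 1 (for even k it is binomial(k,k/2)); what is proved is that it is Theta(2^k/sqrt(k)) and asymptotic to sqrt(2/pi)*2^k/sqrt(k). *)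

theory Defs
  imports Complex_Main "HOL-Library.Landau_Symbols"
begin

text \<open>Subsets of \<open>[k]\<close> are sets of naturals contained in \<open>{1..k}\<close>.  The divisions
  below are exact because of the parity test, and the subtraction does not truncate because an
  odd cardinality is positive.\<close>

definition splits :: "nat set \<Rightarrow> nat set \<Rightarrow> bool" where
  "splits A B \<longleftrightarrow>
     (if even (card B) then card (A \<inter> B) = card B div 2
      else card (A \<inter> B) = (card B - 1) div 2 \<or> card (A \<inter> B) = (card B + 1) div 2)"

definition splitters :: "nat \<Rightarrow> nat set set \<Rightarrow> nat set set" where
  "splitters k \<B> = {A. A \<subseteq> {1..k} \<and> (\<forall>B\<in>\<B>. splits A B)}"

definition min_splitters :: "nat \<Rightarrow> nat" where
  "min_splitters k = Min ((\<lambda>B. card (splitters k {B})) ` Pow {1..k})"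

end

theory Submission
  imports Defs "HOL-Analysis.Gamma_Function"
begin

text \<open>A set \<open>B \<subseteq> [k]\<close> with \<open>2m\<close> elements has \<open>2\<^sup>k p(m)\<close> splitters, where
  \<open>p(m) = binom(2m, m) / 4\<^sup>m\<close>: a splitter is a choice of \<open>m\<close> elements of \<open>B\<close> together with an
  arbitrary subset of the complement of \<open>B\<close>.  Odd sets need no count of their own.  If \<open>card B\<close>
  is odd and \<open>x \<in> B\<close>, then every splitter of \<open>B - {x}\<close> is already a splitter of \<open>B\<close>, because
  putting \<open>x\<close> back changes the intersection by at most one element.  So every \<open>C \<subseteq> [k]\<close> has at
  least \<open>2\<^sup>k p(\<lfloor>card C / 2\<rfloor>)\<close> splitters.

  Since \<open>p(m + 1) / p(m) = (2m + 1) / (2m + 2) < 1\<close>, this bound is smallest for the largest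
  possible \<open>m = \<lfloor>k / 2\<rfloor>\<close>, where the sets of cardinality \<open>2m\<close> attain it.  These are the sets of
  cardinality \<open>k\<close> for even \<open>k\<close> and \<open>k - 1\<close> for odd \<open>k\<close>.

  The same recurrence shows that \<open>p(m)\<close> is the generalised binomial coefficient
  \<open>m - 1/2\<close> over \<open>m\<close>, so Euler's limit for the Gamma function gives
  \<open>p(m) * sqrt m \<longlonglongrightarrow> 1 / \<Gamma>(1/2) = 1 / sqrt \<pi>\<close>.  With \<open>m \<sim> k / 2\<close> this turns into
  the constant \<open>sqrt (2 / \<pi>)\<close> for the minimum.\<close>

section \<open>Counting splitters of one set\<close>

text \<open>Such an \<open>A\<close> is determined by two independent choices: its \<open>j\<close> elements inside \<open>B\<close> and its
  part outside \<open>B\<close>.\<close>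

lemma card_subsets_with_inter_card:
  assumes "finite S" "B \<subseteq> S"
  shows "card {A. A \<subseteq> S \<and> card (A \<inter> B) = j} = 2 ^ (card S - card B) * (card B choose j)"
proof -
  let ?Q = "{K. K \<subseteq> B \<and> card K = j}"
  have fin: "finite B" using assms finite_subset by blast
  have "bij_betw (\<lambda>A. (A - B, A \<inter> B)) {A. A \<subseteq> S \<and> card (A \<inter> B) = j} (Pow (S - B) \<times> ?Q)"
  proof (rule bij_betwI[where g = "\<lambda>(X, Y). X \<union> Y"])
    have "(X \<union> Y) \<inter> B = Y" if "X \<subseteq> S - B" "Y \<subseteq> B" for X Y
      using that by blast
    then show "(\<lambda>(X, Y). X \<union> Y) \<in> Pow (S - B) \<times> ?Q \<rightarrow> {A. A \<subseteq> S \<and> card (A \<inter> B) = j}"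
      using assms(2) by auto
  qed auto
  then have "card {A. A \<subseteq> S \<and> card (A \<inter> B) = j} = card (Pow (S - B) \<times> ?Q)"
    by (rule bij_betw_same_card)
  also have "\<dots> = 2 ^ (card S - card B) * (card B choose j)"
    using assms fin by (simp add: card_cartesian_product card_Pow card_Diff_subset n_subsets)
  finally show ?thesis .
qed

lemma finite_splitters: "finite (splitters k \<B>)"
  by (rule finite_subset[of _ "Pow {1..k}"]) (auto simp: splitters_def)

lemma card_splitters_even:
  assumes "B \<subseteq> {1..k}" "card B = 2 * m"
  shows "card (splitters k {B}) = 2 ^ (k - 2 * m) * (2 * m choose m)"
proof -
  have "splitters k {B} = {A. A \<subseteq> {1..k} \<and> card (A \<inter> B) = m}"
    using assms by (simp add: splitters_def splits_def)
  then show ?thesis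
    using card_subsets_with_inter_card[of "{1..k}" B m] assms by simp
qed

text \<open>An exact half of the \<open>2m\<close> elements of \<open>B - {x}\<close> has \<open>m\<close> elements.  With \<open>x\<close> put back the
  intersection has \<open>m\<close> or \<open>m + 1\<close> elements, and these are the two sizes allowed for
  \<open>card B = 2m + 1\<close>.  The inclusion bounds the count for odd sets from below by that for even
  sets.\<close>

lemma splitters_remove_subset:
  assumes "odd (card B)" "x \<in> B"
  shows "splitters k {B - {x}} \<subseteq> splitters k {B}"
proof
  fix A assume A: "A \<in> splitters k {B - {x}}"
  have fin: "finite B" using assms(1) card.infinite by force
  obtain m where m: "card B = 2 * m + 1" using assms(1) by (elim oddE)
  have "card (B - {x}) = 2 * m" using m assms(2) fin by simp
  then have AB: "A \<subseteq> {1..k}" "card (A \<inter> (B - {x})) = m"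
    using A by (simp_all add: splitters_def splits_def)
  have "card (A \<inter> B) = (if x \<in> A then Suc m else m)"
  proof (cases "x \<in> A")
    case True
    then have "A \<inter> B = insert x (A \<inter> (B - {x}))" using assms(2) by blast
    then show ?thesis using True AB fin by simp
  next
    case False
    then have "A \<inter> B = A \<inter> (B - {x})" by blast
    then show ?thesis using False AB by simp
  qed
  then show "A \<in> splitters k {B}"
    using AB m by (auto simp: splitters_def splits_def)
qed

lemma card_splitters_ge:
  assumes "C \<subseteq> {1..k}"
  shows "2 ^ (k - 2 * (card C div 2)) * (2 * (card C div 2) choose (card C div 2))
           \<le> card (splitters k {C})"
proof (cases "even (card C)")
  case True
  then show ?thesis using card_splitters_even[OF assms, of "card C div 2"] by simp
next
  case False
  then obtain x where x: "x \<in> C" by fastforce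
  have "card (C - {x}) = 2 * (card C div 2)"
    using False x by (simp add: card_Diff_singleton)
  then have count: "card (splitters k {C - {x}}) =
      2 ^ (k - 2 * (card C div 2)) * (2 * (card C div 2) choose (card C div 2))"
    using assms by (intro card_splitters_even) auto
  have "card (splitters k {C - {x}}) \<le> card (splitters k {C})"
    by (intro card_mono finite_splitters splitters_remove_subset False x)
  then show ?thesis by (simp only: count)
qed

section \<open>The normalised central binomial coefficient\<close>

lemma central_binomial_Suc:
  "Suc m * (2 * Suc m choose Suc m) = 2 * (2 * m + 1) * (2 * m choose m)"
proof -
  have "Suc m * (2 * Suc m choose Suc m) = 2 * (Suc m * (Suc (2 * m) choose m))"
    using Suc_times_binomial[of m "Suc (2 * m)"] by (simp add: algebra_simps)
  also have "Suc m * (Suc (2 * m) choose m) = Suc (2 * m) * (2 * m choose m)"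
    using binomial_absorb_comp[of "Suc (2 * m)" m] by (simp add: algebra_simps)
  finally show ?thesis by simp
qed

lemma antimono_normalised_central_binomial:
  "antimono (\<lambda>m. real (2 * m choose m) / 4 ^ m)"
proof (rule decseq_SucI)
  fix m
  have "Suc m * (2 * Suc m choose Suc m) \<le> Suc m * (4 * (2 * m choose m))"
    unfolding central_binomial_Suc by (simp add: algebra_simps)
  then have "(2 * Suc m choose Suc m) \<le> 4 * (2 * m choose m)"
    by (rule Suc_mult_le_cancel1[THEN iffD1])
  then have "real (2 * Suc m choose Suc m) \<le> 4 * real (2 * m choose m)"
    by (metis of_nat_le_iff of_nat_mult of_nat_numeral)
  then have "real (2 * Suc m choose Suc m) / 4 ^ Suc m \<le> 4 * real (2 * m choose m) / 4 ^ Suc m"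
    by (rule divide_right_mono) simp
  then show "real (2 * Suc m choose Suc m) / 4 ^ Suc m \<le> real (2 * m choose m) / 4 ^ m"
    by (simp only: power_Suc)
qed

text \<open>Both sides satisfy the recurrence with factor \<open>m + 1/2\<close>.  In this form the central binomial
  coefficient becomes a value of the Pochhammer symbol at \<open>1/2\<close>, to which the limit formula for the
  Gamma function applies.\<close>

lemma pochhammer_half: "pochhammer (1/2) m = fact m * (real (2 * m choose m) / 4 ^ m)"
proof (induction m)
  case (Suc m)
  have rec: "real (Suc m) * real (2 * Suc m choose Suc m)
      = 2 * (2 * real m + 1) * real (2 * m choose m)"
    using arg_cong[OF central_binomial_Suc, of real m] by (simp only: of_nat_mult) simp
  have "fact (Suc m) * (real (2 * Suc m choose Suc m) / 4 ^ Suc m)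
      = fact m * (real (Suc m) * real (2 * Suc m choose Suc m)) / 4 ^ Suc m"
    by (simp only: fact_Suc) simp
  also have "\<dots> = (1/2 + real m) * (fact m * (real (2 * m choose m) / 4 ^ m))"
    unfolding rec by (simp add: field_simps)
  finally show ?case using Suc by (simp only: pochhammer_Suc) simp
qed auto

text \<open>This is the limit \<open>binom(z + m, m) / m\<^sup>z \<longlonglongrightarrow> 1 / \<Gamma>(z + 1)\<close> at \<open>z = -1/2\<close>, where
  \<open>\<Gamma>(1/2) = sqrt \<pi>\<close>.\<close>

lemma normalised_central_binomial_limit:
  "(\<lambda>m. real (2 * m choose m) / 4 ^ m * sqrt (real m)) \<longlonglongrightarrow> 1 / sqrt pi"
proof -
  have "(\<lambda>m. ((- 1/2 + real m) gchoose m) * exp (1/2 * ln (real m))) \<longlonglongrightarrow> 1 / sqrt pi"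
    using Gamma_gbinomial[of "- 1/2 :: real"]
    by (simp add: rGamma_inverse_Gamma Gamma_one_half_real inverse_eq_divide)
  moreover have "\<forall>\<^sub>F m in sequentially. ((- 1/2 + real m) gchoose m) * exp (1/2 * ln (real m))
      = real (2 * m choose m) / 4 ^ m * sqrt (real m)"
    using eventually_gt_at_top[of 0]
  proof eventually_elim
    case (elim m)
    have "((- 1/2 + real m) gchoose m) = real (2 * m choose m) / 4 ^ m"
      by (simp add: gbinomial_pochhammer' pochhammer_half)
    moreover have "exp (1/2 * ln (real m)) = sqrt (real m)"
      using elim by (simp add: powr_half_sqrt[symmetric] powr_def)
    ultimately show ?case by simp
  qed
  ultimately show ?thesis
    by (rule Lim_transform_eventually)
qed

section \<open>The minimum and its growth\<close>

lemma power_times_central_binomial: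
  assumes "2 * m \<le> k"
  shows "real (2 ^ (k - 2 * m) * (2 * m choose m)) = 2 ^ k * (real (2 * m choose m) / 4 ^ m)"
proof -
  have "(2::real) ^ k = 2 ^ (k - 2 * m) * 4 ^ m"
    using assms power_add[of "2::real" "k - 2 * m" "2 * m"] by (simp add: power_mult)
  then show ?thesis by simp
qed

text \<open>After division by \<open>2\<^sup>k\<close> the count for \<open>B\<close> and the lower bound for \<open>C\<close> are values of one
  antitone sequence, so the comparison reduces to \<open>card C div 2 \<le> k div 2\<close>.\<close>

lemma card_splitters_minimal:
  assumes B: "B \<subseteq> {1..k}" "card B = 2 * (k div 2)" and C: "C \<subseteq> {1..k}"
  shows "card (splitters k {B}) \<le> card (splitters k {C})"
proof -
  define m where "m = card C div 2"
  have "card C \<le> k" using card_mono[OF _ C] by simp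
  then have m: "m \<le> k div 2" "2 * m \<le> k" by (auto simp: m_def)
  have "real (card (splitters k {B}))
      = 2 ^ k * (real (2 * (k div 2) choose (k div 2)) / 4 ^ (k div 2))"
    by (simp only: card_splitters_even[OF B]) (rule power_times_central_binomial, simp)
  also have "\<dots> \<le> 2 ^ k * (real (2 * m choose m) / 4 ^ m)"
    by (rule mult_left_mono[OF antimonoD[OF antimono_normalised_central_binomial m(1)]]) simp
  also have "\<dots> = real (2 ^ (k - 2 * m) * (2 * m choose m))"
    using power_times_central_binomial[OF m(2)] by simp
  also have "\<dots> \<le> real (card (splitters k {C}))"
    using card_splitters_ge[OF C] unfolding m_def by (simp only: of_nat_le_iff)
  finally show ?thesis by simp
qed

lemma min_splitters_eq:
  "real (min_splitters k) = 2 ^ k * (real (2 * (k div 2) choose (k div 2)) / 4 ^ (k div 2))"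
proof -
  let ?B = "{1..2 * (k div 2)}"
  have B: "?B \<subseteq> {1..k}" "card ?B = 2 * (k div 2)" by auto
  have "min_splitters k = card (splitters k {?B})"
    unfolding min_splitters_def
  proof (rule Min_eqI)
    fix y assume "y \<in> (\<lambda>B. card (splitters k {B})) ` Pow {1..k}"
    then show "card (splitters k {?B}) \<le> y"
      using card_splitters_minimal[OF B] by auto
  qed (use B in auto)
  then show ?thesis
    by (simp only: card_splitters_even[OF B]) (rule power_times_central_binomial, simp)
qed

text \<open>The limit of the normalised central binomial coefficient is taken along \<open>m = k div 2\<close>.
  Passing from \<open>sqrt m\<close> to \<open>sqrt k\<close> contributes the factor \<open>sqrt (k / m) \<longlonglongrightarrow> sqrt 2\<close>, for both
  parities of \<open>k\<close> alike, since \<open>2m \<le> k \<le> 2m + 1\<close>.\<close>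

lemma min_splitters_asymp_equiv:
  "(\<lambda>k. real (min_splitters k)) \<sim>[sequentially] (\<lambda>k. sqrt (2 / pi) * (2 ^ k / sqrt (real k)))"
proof (rule asymp_equivI'_const)
  let ?p = "\<lambda>m. real (2 * m choose m) / 4 ^ m"
  have half: "filterlim (\<lambda>k::nat. k div 2) at_top at_top"
    unfolding filterlim_at_top
  proof
    fix Z :: nat
    show "eventually (\<lambda>k. Z \<le> k div 2) at_top"
      using eventually_ge_at_top[of "2 * Z"] by eventually_elim auto
  qed
  have "(\<lambda>k. ?p (k div 2) * sqrt (real (k div 2))) \<longlonglongrightarrow> 1 / sqrt pi"
    using filterlim_compose[OF normalised_central_binomial_limit half] .
  moreover have "(\<lambda>k. sqrt (real k / real (k div 2))) \<longlonglongrightarrow> sqrt 2"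
  proof (rule tendsto_real_sqrt)
    have "(\<lambda>k. 2 + 1 / real (k div 2)) \<longlonglongrightarrow> 2 + 0"
      by (rule tendsto_add[OF tendsto_const real_tendsto_divide_at_top[OF tendsto_const
            filterlim_compose[OF filterlim_real_sequentially half]]])
    then have upper: "(\<lambda>k. 2 + 1 / real (k div 2)) \<longlonglongrightarrow> 2" by simp
    have "\<forall>\<^sub>F k in sequentially. real k / real (k div 2) \<le> 2 + 1 / real (k div 2)"
      using eventually_ge_at_top[of 2]
    proof eventually_elim
      case (elim k)
      have "k \<le> 2 * (k div 2) + 1" by linarith
      then have "real k \<le> 2 * real (k div 2) + 1" by linarith
      then show ?case using elim by (simp add: field_simps)
    qed
    moreover have "\<forall>\<^sub>F k in sequentially. 2 \<le> real k / real (k div 2)"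
      using eventually_ge_at_top[of 2]
    proof eventually_elim
      case (elim k)
      have "2 * (k div 2) \<le> k" by simp
      then have "2 * real (k div 2) \<le> real k" by linarith
      then show ?case using elim by (simp add: field_simps)
    qed
    ultimately show "(\<lambda>k. real k / real (k div 2)) \<longlonglongrightarrow> 2"
      by (intro real_tendsto_sandwich[OF _ _ tendsto_const upper])
  qed
  ultimately have "(\<lambda>k. ?p (k div 2) * sqrt (real (k div 2)) * sqrt (real k / real (k div 2)))
      \<longlonglongrightarrow> 1 / sqrt pi * sqrt 2"
    by (rule tendsto_mult)
  moreover have "\<forall>\<^sub>F k in sequentially.
      ?p (k div 2) * sqrt (real (k div 2)) * sqrt (real k / real (k div 2))
      = real (min_splitters k) / (2 ^ k / sqrt (real k))"
    using eventually_ge_at_top[of 2]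
  proof eventually_elim
    case (elim k)
    then have "sqrt (real (k div 2)) * sqrt (real k / real (k div 2)) = sqrt (real k)"
      unfolding real_sqrt_mult[symmetric] by simp
    then have "?p (k div 2) * sqrt (real (k div 2)) * sqrt (real k / real (k div 2))
        = ?p (k div 2) * sqrt (real k)"
      by (simp only: mult.assoc)
    then show ?case by (simp add: min_splitters_eq)
  qed
  ultimately have "(\<lambda>k. real (min_splitters k) / (2 ^ k / sqrt (real k))) \<longlonglongrightarrow> 1 / sqrt pi * sqrt 2"
    by (rule Lim_transform_eventually)
  then show "(\<lambda>k. real (min_splitters k) / (2 ^ k / sqrt (real k))) \<longlonglongrightarrow> sqrt (2 / pi)"
    by (simp add: real_sqrt_divide)
qed simp

theorem proposition4p1:
  shows "(\<forall>k B C. B \<subseteq> {1..k} \<longrightarrow> card B = (if even k then k else k - 1) \<longrightarrow> C \<subseteq> {1..k} \<longrightarrow>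
            card (splitters k {B}) \<le> card (splitters k {C})) \<and>
         (\<lambda>k. real (min_splitters k)) \<in> \<Theta>(\<lambda>k. 2 ^ k / sqrt (real k)) \<and>
         asymp_equiv (\<lambda>k. real (min_splitters k)) sequentially
           (\<lambda>k. sqrt (2 / pi) * (2 ^ k / sqrt (real k)))"
proof (intro conjI allI impI)
  fix k B C
  assume B: "B \<subseteq> {1..k}" "card B = (if even k then k else k - 1)" and C: "C \<subseteq> {1..k}"
  have "card B = 2 * (k div 2)" using B(2) by (auto elim: oddE)
  then show "card (splitters k {B}) \<le> card (splitters k {C})"
    using card_splitters_minimal B(1) C by blast
next
  show "(\<lambda>k. real (min_splitters k)) \<in> \<Theta>(\<lambda>k. 2 ^ k / sqrt (real k))"
    using asymp_equiv_imp_bigtheta[OF min_splitters_asymp_equiv]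
    by (subst (asm) landau_theta.cmult) simp_all
qed (rule min_splitters_asymp_equiv)

end
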